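(* Let $n$ be a positive integer, let $T=(T_{ijk})_{1\le i,j\le n,\,1\le k\le 2}$ be an $n\times n\times 2$-tensor of independent indeterminates over $\mathbb{C}$, $X=(T_{ij1})$, $Y=(T_{ij2})$, and write $\det(X+Y)=\sum_{k=0}^n f_{k,n-k}$, where $f_{k,n-k}$ is the sum of the terms of degree $k$ in the $T_{ij1}$ and degree $n-k$ in the $T_{ij2}$. Let $\mathrm{SL}(2,\mathbb{C})$ act on $\mathbb{C}[T]$, and hence on $\mathbb{C}[f_{n,0},f_{n-1,1},\ldots,f_{0,n}]$, by the $\mathbb{C}$-algebra automorphisms for which $\begin{pmatrix}\alpha&\beta\\ \gamma&\delta\end{pmatrix}$ sends $X$ to $\alpha X+\gamma Y$ and $Y$ to $\beta X+\delta Y$, and let $\mathrm{SL}(2,\mathbb{C})$ act on $\mathbb{C}[\xi_0,\xi_1,\ldots,\xi_n]$ by the action of the classical invariant theory of binary forms of degree $n$ (described in the context). Then $\mathbb{C}[f_{n,0},f_{n-1,1},\ldots,f_{0,n}]$ is isomorphic to $\mathbb{C}[\xi_0,\xi_1,\ldots,\xi_n]$ as $\mathrm{SL}(2,\mathbb{C})$-modules by the ($\mathbb{C}$-algebra) map $f_{k,n-k}\mapsto\binom{n}{k}\xi_k$ for $k=0,1,\ldots,n$.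
   Context: Classical action: let $x,y,\xi_0,\ldots,\xi_n$ be indeterminates and let $f=\sum_{k=0}^n\binom{n}{k}\xi_kx^ky^{n-k}$. For $\begin{pmatrix}\alpha&\beta\\ \gamma&\delta\end{pmatrix}\in\mathrm{SL}(2,\mathbb{C})$ define $\bar x,\bar y$ by $\begin{pmatrix}x\\ y\end{pmatrix}=\begin{pmatrix}\alpha&\beta\\ \gamma&\delta\end{pmatrix}\begin{pmatrix}\bar x\\ \bar y\end{pmatrix}$. Substituting $x=\alpha\bar x+\beta\bar y$, $y=\gamma\bar x+\delta\bar y$ one writes $$f=\sum_{k=0}^n\binom{n}{k}\xi_k(\alpha\bar x+\beta\bar y)^k(\gamma\bar x+\delta\bar y)^{n-k}=\sum_{k=0}^n\binom{n}{k}\bar\xi_k\bar x^k\bar y^{n-k},$$ which defines $\bar\xi_0,\ldots,\bar\xi_n$ (linear combinations of the $\xi_i$). The action of $\mathrm{SL}(2,\mathbb{C})$ on $\mathbb{C}[\xi_0,\ldots,\xi_n,x,y]$ is by $\mathbb{C}$-algebra automorphisms so that $\begin{pmatrix}\alpha&\beta\\ \gamma&\delta\end{pmatrix}$ maps $x$ to $\bar x$, $y$ to $\bar y$ and $\xi_k$ to $\bar\xi_k$ for $k=0,\ldots,n$; the action on $\mathbb{C}[\xi_0,\ldots,\xi_n]$ is its restriction. *)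

theory Defs
  imports
    "Jordan_Normal_Form.Determinant"
    "HOL-Library.Poly_Mapping"
    "HOL-Library.FuncSet"
begin

hide_const (open) Poly_Mapping.range Poly_Mapping.degree Poly_Mapping.map Poly_Mapping.nth
  Poly_Mapping.update

section \<open>Multivariate polynomials over the complex numbers\<close>

text \<open>A polynomial is a finitely supported function from monomials (finitely supported exponent
  functions) to coefficients; the ring structure is the one of
  \<^theory>\<open>HOL-Library.Poly_Mapping\<close>.\<close>

type_synonym 'v cpoly = "('v \<Rightarrow>\<^sub>0 nat) \<Rightarrow>\<^sub>0 complex"

definition Const :: "complex \<Rightarrow> 'v cpoly" where
  "Const c = Poly_Mapping.single 0 c"

definition Var :: "'v \<Rightarrow> 'v cpoly" where
  "Var v = Poly_Mapping.single (Poly_Mapping.single v 1) 1"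

text \<open>The polynomial ring \<open>\<complex>[V]\<close>, inside the ring of all polynomials in variables of type \<open>'v\<close>.\<close>

definition poly_ring :: "'v set \<Rightarrow> 'v cpoly set" where
  "poly_ring V = {p. \<forall>m \<in> Poly_Mapping.keys p. Poly_Mapping.keys m \<subseteq> V}"

text \<open>The \<open>\<complex>\<close>-subalgebra generated by \<open>S\<close>.\<close>

inductive_set subalgebra_gen :: "'v cpoly set \<Rightarrow> 'v cpoly set" for S :: "'v cpoly set" where
  Const: "Const c \<in> subalgebra_gen S"
| gen: "p \<in> S \<Longrightarrow> p \<in> subalgebra_gen S"
| add: "p \<in> subalgebra_gen S \<Longrightarrow> q \<in> subalgebra_gen S \<Longrightarrow> p + q \<in> subalgebra_gen S"
| mult: "p \<in> subalgebra_gen S \<Longrightarrow> q \<in> subalgebra_gen S \<Longrightarrow> p * q \<in> subalgebra_gen S"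

text \<open>The \<open>\<complex>\<close>-algebra homomorphism that sends each variable \<open>v\<close> to \<open>\<sigma> v\<close>.\<close>

definition poly_subst :: "('v \<Rightarrow> 'w cpoly) \<Rightarrow> 'v cpoly \<Rightarrow> 'w cpoly" where
  "poly_subst \<sigma> p = (\<Sum>m \<in> Poly_Mapping.keys p.
     Const (Poly_Mapping.lookup p m) * (\<Prod>v \<in> Poly_Mapping.keys m. \<sigma> v ^ Poly_Mapping.lookup m v))"

definition alg_hom_on :: "'v cpoly set \<Rightarrow> ('v cpoly \<Rightarrow> 'w cpoly) \<Rightarrow> bool" where
  "alg_hom_on R \<phi> \<longleftrightarrow>
     (\<forall>c. \<phi> (Const c) = Const c) \<and>
     (\<forall>p\<in>R. \<forall>q\<in>R. \<phi> (p + q) = \<phi> p + \<phi> q) \<and>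
     (\<forall>p\<in>R. \<forall>q\<in>R. \<phi> (p * q) = \<phi> p * \<phi> q)"


section \<open>Modules over \<open>SL(2,\<complex>)\<close>\<close>

definition SL2 :: "complex mat set" where
  "SL2 = {A \<in> carrier_mat 2 2. det A = 1}"

definition linear_subspace :: "'v cpoly set \<Rightarrow> bool" where
  "linear_subspace V \<longleftrightarrow> 0 \<in> V \<and> (\<forall>p\<in>V. \<forall>q\<in>V. p + q \<in> V) \<and> (\<forall>c. \<forall>p\<in>V. Const c * p \<in> V)"

definition linear_map_on :: "'v cpoly set \<Rightarrow> ('v cpoly \<Rightarrow> 'w cpoly) \<Rightarrow> bool" where
  "linear_map_on V \<phi> \<longleftrightarrow>
     (\<forall>p\<in>V. \<forall>q\<in>V. \<phi> (p + q) = \<phi> p + \<phi> q) \<and> (\<forall>c. \<forall>p\<in>V. \<phi> (Const c * p) = Const c * \<phi> p)"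

definition SL2_module :: "'v cpoly set \<Rightarrow> (complex mat \<Rightarrow> 'v cpoly \<Rightarrow> 'v cpoly) \<Rightarrow> bool" where
  "SL2_module V act \<longleftrightarrow>
     linear_subspace V \<and>
     (\<forall>A\<in>SL2. act A ` V \<subseteq> V \<and> linear_map_on V (act A)) \<and>
     (\<forall>p\<in>V. act (1\<^sub>m 2) p = p) \<and>
     (\<forall>A\<in>SL2. \<forall>B\<in>SL2. \<forall>p\<in>V. act (A * B) p = act A (act B p))"

definition SL2_module_iso ::
    "'v cpoly set \<Rightarrow> (complex mat \<Rightarrow> 'v cpoly \<Rightarrow> 'v cpoly) \<Rightarrow>
     'w cpoly set \<Rightarrow> (complex mat \<Rightarrow> 'w cpoly \<Rightarrow> 'w cpoly) \<Rightarrow>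
     ('v cpoly \<Rightarrow> 'w cpoly) \<Rightarrow> bool" where
  "SL2_module_iso V act W act' \<phi> \<longleftrightarrow>
     SL2_module V act \<and> SL2_module W act' \<and>
     bij_betw \<phi> V W \<and> linear_map_on V \<phi> \<and>
     (\<forall>A\<in>SL2. \<forall>p\<in>V. \<phi> (act A p) = act' A (\<phi> p))"


section \<open>The \<open>n \<times> n \<times> 2\<close> tensor\<close>

text \<open>The variable \<open>(i, j, k)\<close> is the tensor entry \<open>T\<^sub>i\<^sub>j\<^sub>k\<close>.\<close>

type_synonym tvar = "nat \<times> nat \<times> nat"

definition tensor_vars :: "nat \<Rightarrow> tvar set" where
  "tensor_vars n = {1..n} \<times> {1..n} \<times> {1..2}"

text \<open>The slices \<open>X\<close> (\<open>k = 1\<close>) and \<open>Y\<close> (\<open>k = 2\<close>). Matrix positions start at \<open>0\<close>, the indices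
  of the tensor at \<open>1\<close>.\<close>

definition slice :: "nat \<Rightarrow> nat \<Rightarrow> tvar cpoly mat" where
  "slice n k = mat n n (\<lambda>(i, j). Var (Suc i, Suc j, k))"

definition slice_degree :: "nat \<Rightarrow> (tvar \<Rightarrow>\<^sub>0 nat) \<Rightarrow> nat" where
  "slice_degree k m =
     (\<Sum>v \<in> {v \<in> Poly_Mapping.keys m. snd (snd v) = k}. Poly_Mapping.lookup m v)"

definition bidegree_part :: "nat \<Rightarrow> nat \<Rightarrow> tvar cpoly \<Rightarrow> tvar cpoly" where
  "bidegree_part a b p =
     (\<Sum>m \<in> {m \<in> Poly_Mapping.keys p. slice_degree 1 m = a \<and> slice_degree 2 m = b}.
        Poly_Mapping.single m (Poly_Mapping.lookup p m))"

text \<open>\<open>det_part n k\<close> is \<open>f\<^bsub>k,n-k\<^esub>\<close>.\<close>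

definition det_part :: "nat \<Rightarrow> nat \<Rightarrow> tvar cpoly" where
  "det_part n k = bidegree_part k (n - k) (det (slice n 1 + slice n 2))"

text \<open>With \<open>A\<close> having rows \<open>(\<alpha>, \<beta>)\<close> and \<open>(\<gamma>, \<delta>)\<close>: \<open>X\<close> goes to \<open>\<alpha>X + \<gamma>Y\<close> and \<open>Y\<close> to
  \<open>\<beta>X + \<delta>Y\<close>. The value at third indices other than \<open>1, 2\<close> is irrelevant. That this is an
  action on \<open>\<complex>[T]\<close> is shown in \<open>tensor_act_module\<close> below.\<close>

definition tensor_act :: "complex mat \<Rightarrow> tvar cpoly \<Rightarrow> tvar cpoly" where
  "tensor_act A = poly_subst (\<lambda>(i, j, k).
     if k = 1 then Const (A $$ (0,0)) * Var (i, j, 1) + Const (A $$ (1,0)) * Var (i, j, 2)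
     else if k = 2 then Const (A $$ (0,1)) * Var (i, j, 1) + Const (A $$ (1,1)) * Var (i, j, 2)
     else Var (i, j, k))"


section \<open>Binary forms of degree \<open>n\<close>\<close>

datatype fvar = Xi nat | Xvar | Yvar

definition binary_form :: "nat \<Rightarrow> (nat \<Rightarrow> fvar cpoly) \<Rightarrow> fvar cpoly \<Rightarrow> fvar cpoly \<Rightarrow> fvar cpoly"
  where "binary_form n c x y = (\<Sum>k=0..n. of_nat (n choose k) * c k * x ^ k * y ^ (n - k))"

text \<open>The linear forms \<open>xbar\<close>, \<open>ybar\<close> in \<open>x\<close>, \<open>y\<close> are given by
  \<open>(x, y)\<^sup>T = A (xbar, ybar)\<^sup>T\<close>; since \<open>det A = 1\<close>, the inverse of \<open>A\<close> has rows
  \<open>(\<delta>, -\<beta>)\<close> and \<open>(-\<gamma>, \<alpha>)\<close>.\<close>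

definition xbar :: "complex mat \<Rightarrow> fvar cpoly" where
  "xbar A = Const (A $$ (1,1)) * Var Xvar - Const (A $$ (0,1)) * Var Yvar"

definition ybar :: "complex mat \<Rightarrow> fvar cpoly" where
  "ybar A = Const (A $$ (0,0)) * Var Yvar - Const (A $$ (1,0)) * Var Xvar"

text \<open>The transformed coefficients are defined by rewriting the generic form in terms of \<open>xbar\<close>,
  \<open>ybar\<close>. Existence and uniqueness are shown in \<open>xibar_unique\<close> below.\<close>

definition is_xibar :: "nat \<Rightarrow> complex mat \<Rightarrow> (nat \<Rightarrow> fvar cpoly) \<Rightarrow> bool" where
  "is_xibar n A \<eta> \<longleftrightarrow>
     \<eta> \<in> {0..n} \<rightarrow>\<^sub>E poly_ring (Xi ` {0..n}) \<and>
     binary_form n (\<lambda>k. Var (Xi k)) (Var Xvar) (Var Yvar) = binary_form n \<eta> (xbar A) (ybar A)"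

definition xibar :: "nat \<Rightarrow> complex mat \<Rightarrow> nat \<Rightarrow> fvar cpoly" where
  "xibar n A = (THE \<eta>. is_xibar n A \<eta>)"

text \<open>The action on \<open>\<complex>[\<xi>\<^sub>0, \<dots>, \<xi>\<^sub>n, x, y]\<close>, and by restriction on \<open>\<complex>[\<xi>\<^sub>0, \<dots>, \<xi>\<^sub>n]\<close>.\<close>

definition form_act :: "nat \<Rightarrow> complex mat \<Rightarrow> fvar cpoly \<Rightarrow> fvar cpoly" where
  "form_act n A = poly_subst (\<lambda>v. case v of
     Xi k \<Rightarrow> xibar n A k | Xvar \<Rightarrow> xbar A | Yvar \<Rightarrow> ybar A)"


section \<open>Properties of substitution\<close>

lemma Const_add: "Const (a + b) = Const a + Const b"
  and Const_mult: "Const (a * b) = Const a * Const b"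
  and Const_0 [simp]: "Const 0 = 0"
  and Const_1 [simp]: "Const 1 = 1"
  and Const_uminus: "Const (- a) = - Const a"
  by (simp_all add: Const_def single_add mult_single single_uminus)

lemma Const_diff: "Const (a - b) = Const a - Const b"
  by (simp add: Const_def single_diff)

lemma Const_of_nat [simp]: "Const (of_nat k) = of_nat k"
  by (induction k) (simp_all add: Const_add)

definition monom_subst :: "('v \<Rightarrow> 'w cpoly) \<Rightarrow> ('v \<Rightarrow>\<^sub>0 nat) \<Rightarrow> 'w cpoly" where
  "monom_subst \<sigma> m = (\<Prod>v \<in> Poly_Mapping.keys m. \<sigma> v ^ Poly_Mapping.lookup m v)"

lemma monom_subst_superset:
  assumes "finite K" "Poly_Mapping.keys m \<subseteq> K"
  shows "monom_subst \<sigma> m = (\<Prod>v\<in>K. \<sigma> v ^ Poly_Mapping.lookup m v)"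
  unfolding monom_subst_def using assms
  by (intro prod.mono_neutral_left) (auto simp: in_keys_iff)

lemma monom_subst_add: "monom_subst \<sigma> (m + m') = monom_subst \<sigma> m * monom_subst \<sigma> m'"
proof -
  let ?K = "Poly_Mapping.keys m \<union> Poly_Mapping.keys m'"
  have "monom_subst \<sigma> (m + m') = (\<Prod>v\<in>?K. \<sigma> v ^ Poly_Mapping.lookup (m + m') v)"
    by (rule monom_subst_superset) (use keys_add[of m m'] in auto)
  also have "\<dots> = (\<Prod>v\<in>?K. \<sigma> v ^ Poly_Mapping.lookup m v) * (\<Prod>v\<in>?K. \<sigma> v ^ Poly_Mapping.lookup m' v)"
    by (simp add: lookup_add power_add prod.distrib)
  also have "\<dots> = monom_subst \<sigma> m * monom_subst \<sigma> m'"
    by (simp add: monom_subst_superset[of ?K])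
  finally show ?thesis .
qed

lemma poly_subst_superset:
  assumes "finite K" "Poly_Mapping.keys p \<subseteq> K"
  shows "poly_subst \<sigma> p = (\<Sum>m\<in>K. Const (Poly_Mapping.lookup p m) * monom_subst \<sigma> m)"
  unfolding poly_subst_def monom_subst_def[symmetric] using assms
  by (intro sum.mono_neutral_left) (auto simp: in_keys_iff)

lemma poly_subst_add: "poly_subst \<sigma> (p + q) = poly_subst \<sigma> p + poly_subst \<sigma> q"
proof -
  let ?K = "Poly_Mapping.keys p \<union> Poly_Mapping.keys q"
  have "poly_subst \<sigma> (p + q) = (\<Sum>m\<in>?K. Const (Poly_Mapping.lookup (p + q) m) * monom_subst \<sigma> m)"
    by (rule poly_subst_superset) (use keys_add[of p q] in auto)
  also have "\<dots> = poly_subst \<sigma> p + poly_subst \<sigma> q"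
    by (simp add: lookup_add Const_add algebra_simps sum.distrib poly_subst_superset[of ?K])
  finally show ?thesis .
qed

lemma poly_subst_single: "poly_subst \<sigma> (Poly_Mapping.single m c) = Const c * monom_subst \<sigma> m"
  by (subst poly_subst_superset[of "{m}"]) auto

lemma poly_subst_0 [simp]: "poly_subst \<sigma> 0 = 0"
  by (simp add: poly_subst_def)

lemma poly_subst_Const [simp]: "poly_subst \<sigma> (Const c) = Const c"
  unfolding Const_def[of c] poly_subst_single by (simp add: monom_subst_def Const_def)

lemma poly_subst_1 [simp]: "poly_subst \<sigma> 1 = 1"
  using poly_subst_Const[of \<sigma> 1] by simp

lemma poly_subst_Var [simp]: "poly_subst \<sigma> (Var v) = \<sigma> v"
  by (simp add: Var_def poly_subst_single monom_subst_def)

lemma poly_subst_sum: "poly_subst \<sigma> (sum f S) = (\<Sum>x\<in>S. poly_subst \<sigma> (f x))"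
  by (induction S rule: infinite_finite_induct) (simp_all add: poly_subst_add)

lemma poly_expand:
  "(\<Sum>m \<in> Poly_Mapping.keys p. Poly_Mapping.single m (Poly_Mapping.lookup p m)) = p"
proof (rule poly_mapping_eqI)
  fix k
  show "Poly_Mapping.lookup (\<Sum>m\<in>Poly_Mapping.keys p. Poly_Mapping.single m (Poly_Mapping.lookup p m)) k
      = Poly_Mapping.lookup p k"
    by (simp add: lookup_sum lookup_single when_def sum.delta in_keys_iff)
qed

lemma poly_subst_mult: "poly_subst \<sigma> (p * q) = poly_subst \<sigma> p * poly_subst \<sigma> q"
proof -
  let ?s = "\<lambda>p m. Poly_Mapping.single m (Poly_Mapping.lookup p m)"
  have "poly_subst \<sigma> (p * q) = poly_subst \<sigma>
      ((\<Sum>m \<in> Poly_Mapping.keys p. ?s p m) * (\<Sum>m \<in> Poly_Mapping.keys q. ?s q m))"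
    by (simp only: poly_expand)
  also have "\<dots> = (\<Sum>m \<in> Poly_Mapping.keys p. poly_subst \<sigma> (?s p m)) *
      (\<Sum>m \<in> Poly_Mapping.keys q. poly_subst \<sigma> (?s q m))"
    by (simp add: sum_product mult_single poly_subst_sum poly_subst_single monom_subst_add
        Const_mult mult_ac)
  also have "\<dots> = poly_subst \<sigma> p * poly_subst \<sigma> q"
    by (simp only: poly_subst_sum[symmetric] poly_expand)
  finally show ?thesis .
qed

lemma poly_subst_power: "poly_subst \<sigma> (p ^ k) = poly_subst \<sigma> p ^ k"
  by (induction k) (simp_all add: poly_subst_mult)

lemma poly_subst_prod: "poly_subst \<sigma> (prod f S) = (\<Prod>x\<in>S. poly_subst \<sigma> (f x))"
  by (induction S rule: infinite_finite_induct) (simp_all add: poly_subst_mult)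

lemma poly_subst_of_nat [simp]: "poly_subst \<sigma> (of_nat k) = of_nat k"
  by (induction k) (simp_all add: poly_subst_add)

lemma poly_subst_uminus: "poly_subst \<sigma> (- p) = - poly_subst \<sigma> p"
  by (metis add.right_inverse minus_unique poly_subst_0 poly_subst_add)

lemma poly_subst_diff: "poly_subst \<sigma> (p - q) = poly_subst \<sigma> p - poly_subst \<sigma> q"
  by (metis diff_conv_add_uminus poly_subst_add poly_subst_uminus)

lemmas poly_subst_hom =
  poly_subst_add poly_subst_mult poly_subst_power poly_subst_diff poly_subst_sum poly_subst_prod

lemma poly_subst_poly_subst: "poly_subst \<sigma> (poly_subst \<tau> p) = poly_subst (\<lambda>v. poly_subst \<sigma> (\<tau> v)) p"
  by (simp add: poly_subst_def[of \<tau>] poly_subst_def[of "\<lambda>v. poly_subst \<sigma> (\<tau> v)"] poly_subst_hom)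

lemma poly_subst_cong:
  assumes "p \<in> poly_ring V" "\<And>v. v \<in> V \<Longrightarrow> \<sigma> v = \<tau> v"
  shows "poly_subst \<sigma> p = poly_subst \<tau> p"
proof -
  have "\<sigma> v = \<tau> v" if "m \<in> Poly_Mapping.keys p" "v \<in> Poly_Mapping.keys m" for m v
    using assms that by (auto simp: poly_ring_def)
  then show ?thesis by (simp add: poly_subst_def)
qed

lemma Var_power: "Var v ^ k = Poly_Mapping.single (Poly_Mapping.single v k) 1"
  by (induction k) (simp_all add: Var_def mult_single single_add[symmetric])

lemma poly_subst_Var_id [simp]: "poly_subst Var p = p"
proof -
  have "monom_subst Var m = Poly_Mapping.single m 1" for m :: "'a \<Rightarrow>\<^sub>0 nat"
  proof -
    have prod: "(\<Prod>v\<in>K. Poly_Mapping.single (f v) 1) = Poly_Mapping.single (\<Sum>v\<in>K. f v) (1::complex)"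
      for K :: "'a set" and f :: "'a \<Rightarrow> 'a \<Rightarrow>\<^sub>0 nat"
      by (induction K rule: infinite_finite_induct) (simp_all add: mult_single)
    have "(\<Sum>v \<in> Poly_Mapping.keys m. Poly_Mapping.single v (Poly_Mapping.lookup m v)) = m"
      by (rule poly_mapping_eqI) (simp add: lookup_sum lookup_single when_def sum.delta in_keys_iff)
    then show ?thesis by (simp add: monom_subst_def Var_power prod)
  qed
  then have "poly_subst Var p =
      (\<Sum>m \<in> Poly_Mapping.keys p. Poly_Mapping.single m (Poly_Mapping.lookup p m))"
    unfolding poly_subst_def monom_subst_def[symmetric]
    by (simp add: Const_def mult_single)
  then show ?thesis by (simp only: poly_expand)
qed

lemma poly_ring_Const [simp]: "Const c \<in> poly_ring V"
  by (simp add: poly_ring_def Const_def)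

lemma poly_ring_0 [simp]: "0 \<in> poly_ring V"
  by (simp add: poly_ring_def)

lemma poly_ring_1 [simp]: "1 \<in> poly_ring V"
  by (simp add: poly_ring_def)

lemma poly_ring_Var [simp]: "v \<in> V \<Longrightarrow> Var v \<in> poly_ring V"
  by (simp add: poly_ring_def Var_def)

lemma poly_ring_add: "p \<in> poly_ring V \<Longrightarrow> q \<in> poly_ring V \<Longrightarrow> p + q \<in> poly_ring V"
  using keys_add[of p q] by (auto simp: poly_ring_def)

lemma poly_ring_mult: "p \<in> poly_ring V \<Longrightarrow> q \<in> poly_ring V \<Longrightarrow> p * q \<in> poly_ring V"
proof -
  assume p: "p \<in> poly_ring V" and q: "q \<in> poly_ring V"
  have "Poly_Mapping.keys m \<subseteq> V" if "m \<in> Poly_Mapping.keys (p * q)" for m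
  proof -
    obtain a b where "m = a + b" "a \<in> Poly_Mapping.keys p" "b \<in> Poly_Mapping.keys q"
      using \<open>m \<in> Poly_Mapping.keys (p * q)\<close> keys_mult[of p q] by blast
    then show ?thesis using p q keys_add[of a b] unfolding poly_ring_def by blast
  qed
  then show ?thesis by (simp add: poly_ring_def)
qed

lemma poly_ring_uminus: "p \<in> poly_ring V \<Longrightarrow> - p \<in> poly_ring V"
  using poly_ring_mult[OF poly_ring_Const[of "-1"], of p V] by (simp add: Const_uminus)

lemma poly_ring_sum: "(\<And>x. x \<in> S \<Longrightarrow> f x \<in> poly_ring V) \<Longrightarrow> sum f S \<in> poly_ring V"
  by (induction S rule: infinite_finite_induct) (simp_all add: poly_ring_add)

lemma poly_ring_prod: "(\<And>x. x \<in> S \<Longrightarrow> f x \<in> poly_ring V) \<Longrightarrow> prod f S \<in> poly_ring V"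
  by (induction S rule: infinite_finite_induct) (simp_all add: poly_ring_mult)

lemma poly_ring_power: "p \<in> poly_ring V \<Longrightarrow> p ^ k \<in> poly_ring V"
  by (induction k) (simp_all add: poly_ring_mult)

lemma poly_subst_in_poly_ring:
  assumes "p \<in> poly_ring V" "\<And>v. v \<in> V \<Longrightarrow> \<sigma> v \<in> poly_ring W"
  shows "poly_subst \<sigma> p \<in> poly_ring W"
proof -
  have "\<sigma> v \<in> poly_ring W" if "m \<in> Poly_Mapping.keys p" "v \<in> Poly_Mapping.keys m" for m v
    using assms(1) that by (intro assms(2)) (auto simp: poly_ring_def)
  then show ?thesis unfolding poly_subst_def
    by (intro poly_ring_sum poly_ring_mult poly_ring_prod poly_ring_power poly_ring_Const)
qed

lemma poly_ring_eq_subalgebra_gen: "poly_ring V = subalgebra_gen (Var ` V)"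
proof
  show "subalgebra_gen (Var ` V) \<subseteq> poly_ring V"
  proof
    fix p assume "p \<in> subalgebra_gen (Var ` V)"
    then show "p \<in> poly_ring V"
      by induction (auto intro: poly_ring_add poly_ring_mult)
  qed
  let ?S = "subalgebra_gen (Var ` V)"
  have zero: "0 \<in> ?S" and one: "1 \<in> ?S"
    using subalgebra_gen.Const[of 0] subalgebra_gen.Const[of 1] by simp_all
  have sum: "sum f K \<in> ?S" if "\<And>x. x \<in> K \<Longrightarrow> f x \<in> ?S" for f and K :: "('a \<Rightarrow>\<^sub>0 nat) set"
    using that zero
    by (induction K rule: infinite_finite_induct) (simp_all add: subalgebra_gen.add)
  have pow: "p ^ k \<in> ?S" if "p \<in> ?S" for p k
    using that one by (induction k) (simp_all add: subalgebra_gen.mult)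
  have prod: "prod f K \<in> ?S" if "\<And>x. x \<in> K \<Longrightarrow> f x \<in> ?S" for f and K :: "'a set"
    using that one
    by (induction K rule: infinite_finite_induct) (simp_all add: subalgebra_gen.mult)
  show "poly_ring V \<subseteq> ?S"
  proof
    fix p assume p: "p \<in> poly_ring V"
    have "poly_subst Var p \<in> ?S" unfolding poly_subst_def
      using p by (intro sum subalgebra_gen.mult prod pow subalgebra_gen.Const subalgebra_gen.gen)
        (auto simp: poly_ring_def)
    then show "p \<in> ?S" by simp
  qed
qed


section \<open>The two actions are well-defined\<close>

lemma SL2_entries:
  assumes "A \<in> SL2"
  shows "A $$ (0,0) * A $$ (1,1) - A $$ (0,1) * A $$ (1,0) = 1"
proof -
  have A: "A \<in> carrier_mat 2 2" and d: "det A = 1" using assms by (auto simp: SL2_def)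
  have "mat_delete A 0 0 \<in> carrier_mat 1 1" "mat_delete A 0 1 \<in> carrier_mat 1 1"
    using A by (auto simp: mat_delete_def)
  then have c: "cofactor A 0 0 = A $$ (1,1)" "cofactor A 0 1 = - A $$ (1,0)"
    using A by (simp_all add: cofactor_def det_single) (simp_all add: mat_delete_def)
  have "det A = (\<Sum>j<2. A $$ (0,j) * cofactor A 0 j)"
    by (rule laplace_expansion_row[OF A]) simp
  then show ?thesis using d c by (simp add: numeral_2_eq_2)
qed

lemma mult_entries:
  assumes "A \<in> carrier_mat 2 2" "B \<in> carrier_mat 2 2" "i < 2" "j < 2"
  shows "(A * B) $$ (i, j) = A $$ (i, 0) * B $$ (0, j) + A $$ (i, 1) * (B $$ (1, j) :: complex)"
  using assms by (auto simp: scalar_prod_def numeral_2_eq_2)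

lemma tensor_act_module: "SL2_module (poly_ring (tensor_vars n)) tensor_act"
proof -
  have "tensor_act A p \<in> poly_ring (tensor_vars n)" if "p \<in> poly_ring (tensor_vars n)" for A p
    unfolding tensor_act_def using that
    by (rule poly_subst_in_poly_ring)
       (auto intro!: poly_ring_add poly_ring_mult simp: tensor_vars_def)
  moreover have "tensor_act (1\<^sub>m 2) p = p" for p
  proof -
    have "(\<lambda>(i, j, k). if k = 1 then Const (1\<^sub>m 2 $$ (0,0)) * Var (i, j, 1) + Const (1\<^sub>m 2 $$ (1,0)) * Var (i, j, 2)
     else if k = 2 then Const (1\<^sub>m 2 $$ (0,1)) * Var (i, j, 1) + Const (1\<^sub>m 2 $$ (1,1)) * Var (i, j, 2)
     else Var (i, j, k)) = (Var :: tvar \<Rightarrow> _)" by (auto simp: fun_eq_iff)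
    then show ?thesis unfolding tensor_act_def by simp
  qed
  moreover have "tensor_act (A * B) p = tensor_act A (tensor_act B p)" if "A \<in> SL2" "B \<in> SL2" for A B p
    unfolding tensor_act_def poly_subst_poly_subst
    using that
    by (intro arg_cong[of _ _ "\<lambda>f. poly_subst f p"])
       (auto simp: fun_eq_iff SL2_def mult_entries poly_subst_hom Const_add Const_mult algebra_simps)
  ultimately show ?thesis
    unfolding SL2_module_def linear_subspace_def linear_map_on_def
    by (auto intro: poly_ring_add poly_ring_mult simp: tensor_act_def poly_subst_hom)
qed

lemma xbar_ybar:
  assumes "A \<in> SL2"
  shows "Var Xvar = Const (A $$ (0,0)) * xbar A + Const (A $$ (0,1)) * ybar A"
    and "Var Yvar = Const (A $$ (1,0)) * xbar A + Const (A $$ (1,1)) * ybar A"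
proof -
  have d: "Const (A $$ (0,0)) * Const (A $$ (1,1)) - Const (A $$ (0,1)) * Const (A $$ (1,0)) = (1 :: fvar cpoly)"
    by (simp only: Const_mult[symmetric] Const_diff[symmetric] Const_1 SL2_entries[OF assms])
  have "Const (A $$ (0,0)) * xbar A + Const (A $$ (0,1)) * ybar A =
    (Const (A $$ (0,0)) * Const (A $$ (1,1)) - Const (A $$ (0,1)) * Const (A $$ (1,0))) * Var Xvar"
    by (simp add: xbar_def ybar_def algebra_simps)
  then show "Var Xvar = Const (A $$ (0,0)) * xbar A + Const (A $$ (0,1)) * ybar A"
    by (simp only: d mult_1_left)
  have "Const (A $$ (1,0)) * xbar A + Const (A $$ (1,1)) * ybar A =
    (Const (A $$ (0,0)) * Const (A $$ (1,1)) - Const (A $$ (0,1)) * Const (A $$ (1,0))) * Var Yvar"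
    by (simp add: xbar_def ybar_def algebra_simps)
  then show "Var Yvar = Const (A $$ (1,0)) * xbar A + Const (A $$ (1,1)) * ybar A"
    by (simp only: d mult_1_left)
qed

lemma linear_forms_product:
  "\<exists>c. \<forall>x y :: fvar cpoly. (Const a * x + Const b * y) ^ k * (Const a' * x + Const b' * y) ^ l =
     (\<Sum>j=0..k+l. Const (c j) * x ^ j * y ^ (k + l - j))"
proof -
  have step: "\<exists>c'. \<forall>x y :: fvar cpoly. (Const a * x + Const b * y) * (\<Sum>j=0..m. Const (c j) * x ^ j * y ^ (m - j)) =
     (\<Sum>j=0..Suc m. Const (c' j) * x ^ j * y ^ (Suc m - j))" for a b c m
  proof (intro exI allI)
    fix x y :: "fvar cpoly"
    let ?c = "\<lambda>j. (if j = 0 then 0 else a * c (j - 1)) + (if j = Suc m then 0 else b * c j)"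
    have 1: "(\<Sum>j=0..Suc m. Const (if j = 0 then 0 else a * c (j - 1)) * x ^ j * y ^ (Suc m - j))
      = Const a * x * (\<Sum>j=0..m. Const (c j) * x ^ j * y ^ (m - j))"
      by (subst sum.atLeast0_atMost_Suc_shift)
         (simp add: sum_distrib_left Const_mult mult_ac del: sum.cl_ivl_Suc)
    have 2: "(\<Sum>j=0..Suc m. Const (if j = Suc m then 0 else b * c j) * x ^ j * y ^ (Suc m - j))
      = Const b * y * (\<Sum>j=0..m. Const (c j) * x ^ j * y ^ (m - j))"
      by (simp, unfold sum_distrib_left, intro sum.cong) (auto simp: Const_mult mult_ac Suc_diff_le)
    show "(Const a * x + Const b * y) * (\<Sum>j=0..m. Const (c j) * x ^ j * y ^ (m - j)) =
     (\<Sum>j=0..Suc m. Const (?c j) * x ^ j * y ^ (Suc m - j))"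
      unfolding Const_add distrib_right sum.distrib 1 2 ..
  qed
  show ?thesis
  proof (induction k)
    case 0
    show ?case
    proof (induction l)
      case 0
      show ?case by (intro exI[of _ "\<lambda>_. 1"]) simp
    next
      case (Suc l)
      then obtain c where c: "\<And>x y :: fvar cpoly. (Const a' * x + Const b' * y) ^ l =
        (\<Sum>j=0..l. Const (c j) * x ^ j * y ^ (l - j))" by auto
      from step[where a=a' and b=b' and m=l and c=c] show ?case by (simp add: c del: sum.cl_ivl_Suc)
    qed
  next
    case (Suc k)
    then obtain c where c: "\<And>x y :: fvar cpoly.
      (Const a * x + Const b * y) ^ k * (Const a' * x + Const b' * y) ^ l =
      (\<Sum>j=0..k+l. Const (c j) * x ^ j * y ^ (k + l - j))" by auto
    from step[where a=a and b=b and m="k + l" and c=c] show ?case by (simp add: c mult.assoc del: sum.cl_ivl_Suc)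
  qed
qed

lemma binary_form_coeff:
  assumes c: "\<And>k. k \<le> n \<Longrightarrow> c k \<in> poly_ring (range Xi)" and m: "Poly_Mapping.keys m \<subseteq> range Xi"
    and j: "j \<le> n"
  shows "Poly_Mapping.lookup (binary_form n c (Var Xvar) (Var Yvar))
      (m + (Poly_Mapping.single Xvar j + Poly_Mapping.single Yvar (n - j)))
    = of_nat (n choose j) * Poly_Mapping.lookup (c j) m"
proof -
  let ?s = "\<lambda>k. Poly_Mapping.single Xvar k + Poly_Mapping.single Yvar (n - k)"
  have shift: "Poly_Mapping.lookup (p * Poly_Mapping.single s 1) (m + s) = Poly_Mapping.lookup p m"
    for p :: "fvar cpoly" and m s
  proof -
    have "p * Poly_Mapping.single s 1 =
      (\<Sum>t \<in> Poly_Mapping.keys p. Poly_Mapping.single (t + s) (Poly_Mapping.lookup p t))"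
      by (subst poly_expand[of p, symmetric]) (simp add: sum_distrib_right mult_single)
    then show ?thesis
      by (simp add: lookup_sum lookup_single when_def sum.delta in_keys_iff)
  qed
  have other: "Poly_Mapping.lookup (p * Poly_Mapping.single (?s k) 1) (m + ?s j) = 0"
    if "p \<in> poly_ring (range Xi)" "k \<noteq> j" for p :: "fvar cpoly" and k
  proof (rule ccontr)
    assume "\<not> ?thesis"
    then have "m + ?s j \<in> Poly_Mapping.keys (p * Poly_Mapping.single (?s k) 1)"
      by (simp add: in_keys_iff)
    with keys_mult obtain t where t: "t \<in> Poly_Mapping.keys p" "m + ?s j = t + ?s k" by fastforce
    have "Poly_Mapping.keys t \<subseteq> range Xi" using t that by (auto simp: poly_ring_def)
    then have "Poly_Mapping.lookup t Xvar = 0" "Poly_Mapping.lookup m Xvar = 0"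
      using m by (auto simp: in_keys_iff)
    with arg_cong[OF t(2), of "\<lambda>u. Poly_Mapping.lookup u Xvar"] \<open>k \<noteq> j\<close>
    show False by (simp add: lookup_add lookup_single)
  qed
  have form: "binary_form n c (Var Xvar) (Var Yvar) =
    (\<Sum>k=0..n. (of_nat (n choose k) * c k) * Poly_Mapping.single (?s k) 1)"
    by (simp add: binary_form_def Var_power mult_single mult.assoc)
  have in_ring: "of_nat (n choose k) * c k \<in> poly_ring (range Xi)" if "k \<le> n" for k
    using poly_ring_mult[OF poly_ring_Const[of "of_nat (n choose k)"] c[OF that]] by simp
  have "Poly_Mapping.lookup (binary_form n c (Var Xvar) (Var Yvar)) (m + ?s j) =
    (\<Sum>k=0..n. if k = j then Poly_Mapping.lookup (of_nat (n choose j) * c j) m else 0)"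
    unfolding form lookup_sum
    by (intro sum.cong refl) (auto simp: shift intro: other[OF in_ring])
  also have "\<dots> = Poly_Mapping.lookup (of_nat (n choose j) * c j) m" using j by simp
  also have "of_nat (n choose j) * c j = Poly_Mapping.map ((*) (of_nat (n choose j))) (c j)"
    unfolding mult_map_scale_conv_mult by simp
  also have "Poly_Mapping.lookup \<dots> m = of_nat (n choose j) * Poly_Mapping.lookup (c j) m"
    by (simp add: Poly_Mapping.map.rep_eq when_def)
  finally show ?thesis .
qed

lemma xibar_unique:
  assumes A: "A \<in> SL2"
  shows "\<exists>!\<eta>. is_xibar n A \<eta>"
proof -
  let ?R = "poly_ring (Xi ` {0..n})"
  let ?a = "A $$ (0,0)" and ?b = "A $$ (0,1)" and ?c = "A $$ (1,0)" and ?d = "A $$ (1,1)"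
  have "\<forall>k. \<exists>e. \<forall>x y :: fvar cpoly. (Const ?a * x + Const ?b * y) ^ k * (Const ?c * x + Const ?d * y) ^ (n - k) =
     (\<Sum>j=0..k+(n-k). Const (e j) * x ^ j * y ^ (k + (n - k) - j))"
    by (intro allI linear_forms_product)
  from choice[OF this] obtain e where e: "\<And>k x y. (Const ?a * x + Const ?b * y) ^ k * (Const ?c * x + Const ?d * y) ^ (n - k) =
     (\<Sum>j=0..k+(n-k). Const (e k j) * (x :: fvar cpoly) ^ j * y ^ (k + (n - k) - j))" by blast
  define \<eta> where "\<eta> = restrict (\<lambda>j. \<Sum>k=0..n. Const (of_nat (n choose k) * e k j / of_nat (n choose j)) * Var (Xi k)) {0..n}"
  have \<eta>_in: "\<eta> \<in> {0..n} \<rightarrow>\<^sub>E ?R"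
    unfolding \<eta>_def by (auto intro!: poly_ring_sum poly_ring_mult)
  have "binary_form n (\<lambda>k. Var (Xi k)) (Var Xvar) (Var Yvar) =
    (\<Sum>k=0..n. of_nat (n choose k) * Var (Xi k) *
      ((Const ?a * xbar A + Const ?b * ybar A) ^ k * (Const ?c * xbar A + Const ?d * ybar A) ^ (n - k)))"
    unfolding binary_form_def xbar_ybar[OF A, symmetric] by (simp add: mult.assoc)
  also have "\<dots> = (\<Sum>k=0..n. \<Sum>j=0..n. of_nat (n choose k) * Var (Xi k) *
      (Const (e k j) * xbar A ^ j * ybar A ^ (n - j)))"
    unfolding e sum_distrib_left by simp
  also have "\<dots> = (\<Sum>j=0..n. \<Sum>k=0..n. of_nat (n choose k) * Var (Xi k) *
      (Const (e k j) * xbar A ^ j * ybar A ^ (n - j)))"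
    by (rule sum.swap)
  also have "\<dots> = binary_form n \<eta> (xbar A) (ybar A)"
    unfolding binary_form_def
  proof (intro sum.cong refl)
    fix j assume j: "j \<in> {0..n}"
    have "Const (of_nat (n choose k) * e k j) = of_nat (n choose j) *
        (Const (of_nat (n choose k) * e k j / of_nat (n choose j)) :: fvar cpoly)" for k
      using j by (simp flip: Const_of_nat Const_mult)
    then have *: "of_nat (n choose k) * Const (e k j) = of_nat (n choose j) *
        (Const (of_nat (n choose k) * e k j / of_nat (n choose j)) :: fvar cpoly)" for k
      by (simp add: Const_mult)
    have "of_nat (n choose j) * \<eta> j * xbar A ^ j * ybar A ^ (n - j) =
      (\<Sum>k=0..n. (of_nat (n choose j) * Const (of_nat (n choose k) * e k j / of_nat (n choose j)))
          * Var (Xi k) * xbar A ^ j * ybar A ^ (n - j))"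
      using j by (simp add: \<eta>_def sum_distrib_left sum_distrib_right mult.assoc)
    also have "\<dots> = (\<Sum>k=0..n. of_nat (n choose k) * Var (Xi k) *
      (Const (e k j) * xbar A ^ j * ybar A ^ (n - j)))"
      unfolding *[symmetric] by (simp add: mult_ac)
    finally show "(\<Sum>k=0..n. of_nat (n choose k) * Var (Xi k) *
      (Const (e k j) * xbar A ^ j * ybar A ^ (n - j))) =
      of_nat (n choose j) * \<eta> j * xbar A ^ j * ybar A ^ (n - j)" ..
  qed
  finally have ex: "is_xibar n A \<eta>" using \<eta>_in by (simp add: is_xibar_def)
  have "\<eta>\<^sub>1 = \<eta>\<^sub>2" if "is_xibar n A \<eta>\<^sub>1" "is_xibar n A \<eta>\<^sub>2" for \<eta>\<^sub>1 \<eta>\<^sub>2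
  proof -
    let ?\<sigma> = "\<lambda>v. case v of Xi k \<Rightarrow> Var (Xi k)
      | Xvar \<Rightarrow> Const ?a * Var Xvar + Const ?b * Var Yvar
      | Yvar \<Rightarrow> Const ?c * Var Xvar + Const ?d * (Var Yvar :: fvar cpoly)"
    have det: "Const ?a * Const ?d - Const ?b * Const ?c = (1 :: fvar cpoly)"
      by (simp only: Const_mult[symmetric] Const_diff[symmetric] Const_1 SL2_entries[OF A])
    have "poly_subst ?\<sigma> (xbar A) = (Const ?a * Const ?d - Const ?b * Const ?c) * Var Xvar"
      by (simp add: xbar_def poly_subst_hom algebra_simps)
    then have x: "poly_subst ?\<sigma> (xbar A) = Var Xvar" by (simp only: det mult_1_left)
    have "poly_subst ?\<sigma> (ybar A) = (Const ?a * Const ?d - Const ?b * Const ?c) * Var Yvar"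
      by (simp add: ybar_def poly_subst_hom algebra_simps)
    then have y: "poly_subst ?\<sigma> (ybar A) = Var Yvar" by (simp only: det mult_1_left)
    have fix_xi: "poly_subst ?\<sigma> p = p" if "p \<in> ?R" for p
    proof -
      have "poly_subst ?\<sigma> p = poly_subst Var p"
        by (rule poly_subst_cong[OF that]) auto
      then show ?thesis by simp
    qed
    have subst: "poly_subst ?\<sigma> (binary_form n \<eta> (xbar A) (ybar A)) = binary_form n \<eta> (Var Xvar) (Var Yvar)"
      if "\<eta> \<in> {0..n} \<rightarrow>\<^sub>E ?R" for \<eta>
      unfolding binary_form_def poly_subst_hom poly_subst_of_nat x y
      by (intro sum.cong refl) (simp only: fix_xi[OF PiE_mem[OF that]])
    have eq: "binary_form n \<eta>\<^sub>1 (Var Xvar) (Var Yvar) = binary_form n \<eta>\<^sub>2 (Var Xvar) (Var Yvar)"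
      using that subst by (metis is_xibar_def)
    have mem: "\<eta>\<^sub>1 k \<in> ?R" "\<eta>\<^sub>2 k \<in> ?R" if "k \<le> n" for k
      using \<open>is_xibar n A \<eta>\<^sub>1\<close> \<open>is_xibar n A \<eta>\<^sub>2\<close> that by (auto simp: is_xibar_def)
    have mem': "\<eta>\<^sub>1 k \<in> poly_ring (range Xi)" "\<eta>\<^sub>2 k \<in> poly_ring (range Xi)" if "k \<le> n" for k
      using mem[OF that] by (fastforce simp: poly_ring_def)+
    have "\<eta>\<^sub>1 j = \<eta>\<^sub>2 j" if j: "j \<le> n" for j
    proof (rule poly_mapping_eqI)
      fix m
      show "Poly_Mapping.lookup (\<eta>\<^sub>1 j) m = Poly_Mapping.lookup (\<eta>\<^sub>2 j) m"
      proof (cases "Poly_Mapping.keys m \<subseteq> range Xi")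
        case True
        have "of_nat (n choose j) * Poly_Mapping.lookup (\<eta>\<^sub>1 j) m =
          of_nat (n choose j) * Poly_Mapping.lookup (\<eta>\<^sub>2 j) m"
          using binary_form_coeff[of n \<eta>\<^sub>1, OF mem'(1) True j]
            binary_form_coeff[of n \<eta>\<^sub>2, OF mem'(2) True j] eq by metis
        then show ?thesis using j by simp
      next
        case False
        then have "m \<notin> Poly_Mapping.keys (\<eta>\<^sub>1 j)" "m \<notin> Poly_Mapping.keys (\<eta>\<^sub>2 j)"
          using mem'[OF j] by (auto simp: poly_ring_def)
        then show ?thesis by (simp add: in_keys_iff)
      qed
    qed
    then show ?thesis
      using that by (intro extensionalityI[of _ "{0..n}"]) (auto simp: is_xibar_def PiE_def)
  qed
  then show ?thesis using ex by blast
qed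

end

theory Submission
  imports Defs
begin

text \<open>The generic form \<open>\<Sum>\<^sub>k binom(n,k) \<xi>\<^sub>k s\<^sup>k t\<^sup>n\<^sup>-\<^sup>k\<close> is the determinant of an explicit companion
  pencil \<open>s P + t Q\<close> with entries in \<open>\<complex>[\<xi>\<^sub>0, \<dots>, \<xi>\<^sub>n]\<close>. Since
  \<open>det (s X + t Y) = \<Sum>\<^sub>k f\<^bsub>k,n-k\<^esub> s\<^sup>k t\<^sup>n\<^sup>-\<^sup>k\<close>, the specialisation \<open>X \<mapsto> P\<close>, \<open>Y \<mapsto> Q\<close> sends \<open>f\<^bsub>k,n-k\<^esub>\<close> to
  \<open>binom(n,k) \<xi>\<^sub>k\<close>: it is the required map, and it shows at once that the \<open>f\<^bsub>k,n-k\<^esub>\<close> are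
  algebraically independent. It is equivariant because acting on \<open>(X, Y)\<close> by a matrix \<open>A\<close> amounts to
  substituting \<open>A (s, t)\<^sup>T\<close> for \<open>(s, t)\<close> in \<open>det (s X + t Y)\<close>.\<close>

section \<open>Substitution on generated subalgebras\<close>

lemma comm_ring_hom_poly_subst: "comm_ring_hom (poly_subst \<sigma>)"
  by unfold_locales (simp_all add: poly_subst_hom)

lemma lookup_Const_mult:
  "Poly_Mapping.lookup (Const c * p) m = c * Poly_Mapping.lookup p m"
proof -
  have "Const c * p = Poly_Mapping.map ((*) c) p"
    unfolding mult_map_scale_conv_mult by (simp add: Const_def)
  then show ?thesis by (simp add: Poly_Mapping.map.rep_eq when_def)
qed

lemma Const_power: "Const c ^ k = Const (c ^ k)"
  by (induction k) (simp_all add: Const_mult)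

lemma of_nat_Const_inverse_mult:
  fixes p :: "'v cpoly"
  assumes "k \<noteq> 0"
  shows "of_nat k * (Const (1 / of_nat k) * p) = p"
    and "Const (1 / of_nat k) * (of_nat k * p) = p"
proof -
  have "of_nat k * Const (1 / of_nat k) = (Const (of_nat k * (1 / of_nat k)) :: 'v cpoly)"
    by (simp only: Const_mult Const_of_nat)
  also have "\<dots> = 1" using assms by simp
  finally show "of_nat k * (Const (1 / of_nat k) * p) = p"
    by (simp only: mult.assoc[symmetric] mult_1_left)
  then show "Const (1 / of_nat k) * (of_nat k * p) = p" by (simp only: mult.left_commute)
qed

text \<open>At each monomial \<open>m\<close> the hypothesis equates two complex polynomial
  functions of \<open>s\<close>, and these determine their coefficients. Thus letting
  \<open>s\<close> run through the constants replaces adjoining a new indeterminate.\<close>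

lemma poly_coeffs_eqI:
  fixes g h :: "nat \<Rightarrow> 'v cpoly"
  assumes eq: "\<And>s. (\<Sum>k=0..n. Const (s ^ k) * g k) = (\<Sum>k=0..n. Const (s ^ k) * h k)"
    and "k \<le> n"
  shows "g k = h k"
proof (rule poly_mapping_eqI)
  fix m
  have "(\<Sum>k\<le>n. Poly_Mapping.lookup (g k) m * s ^ k) = (\<Sum>k\<le>n. Poly_Mapping.lookup (h k) m * s ^ k)"
    for s
    using arg_cong[OF eq[of s], of "\<lambda>p. Poly_Mapping.lookup p m"]
    by (simp only: lookup_sum lookup_Const_mult atLeast0AtMost mult.commute[of _ "s ^ _"])
  then show "Poly_Mapping.lookup (g k) m = Poly_Mapping.lookup (h k) m"
    using \<open>k \<le> n\<close> polyfun_eq_coeffs[of "\<lambda>k. Poly_Mapping.lookup (g k) m" n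
        "\<lambda>k. Poly_Mapping.lookup (h k) m"] by blast
qed

lemma poly_subst_in_subalgebra_gen:
  assumes "p \<in> subalgebra_gen S" "\<And>q. q \<in> S \<Longrightarrow> poly_subst \<sigma> q \<in> subalgebra_gen T"
  shows "poly_subst \<sigma> p \<in> subalgebra_gen T"
  using assms(1)
  by induction (auto simp: poly_subst_hom intro: subalgebra_gen.intros assms(2))

text \<open>Both composites are algebra homomorphisms, so agreement on generators is enough. This
  gives the inverse laws and the equivariance below.\<close>

lemma poly_subst_comp_eq_on_subalgebra_gen:
  assumes "p \<in> subalgebra_gen S"
    and "\<And>q. q \<in> S \<Longrightarrow> poly_subst \<sigma> (poly_subst \<tau> q) = poly_subst \<sigma>' (poly_subst \<tau>' q)"
  shows "poly_subst \<sigma> (poly_subst \<tau> p) = poly_subst \<sigma>' (poly_subst \<tau>' p)"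
  using assms(1) by induction (simp_all add: poly_subst_hom assms(2))

lemma poly_subst_comp_id_on_subalgebra_gen:
  assumes "p \<in> subalgebra_gen S" "\<And>q. q \<in> S \<Longrightarrow> poly_subst \<sigma> (poly_subst \<tau> q) = q"
  shows "poly_subst \<sigma> (poly_subst \<tau> p) = p"
  using poly_subst_comp_eq_on_subalgebra_gen[OF assms(1), of \<sigma> \<tau> Var Var] assms(2) by simp

lemma subalgebra_gen_sum:
  "(\<And>x. x \<in> K \<Longrightarrow> f x \<in> subalgebra_gen S) \<Longrightarrow> sum f K \<in> subalgebra_gen S"
  using subalgebra_gen.Const[of 0 S]
  by (induction K rule: infinite_finite_induct) (simp_all add: subalgebra_gen.add)


section \<open>The expansion of \<open>det (s X + t Y)\<close>\<close>

lemma slice_degree_superset: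
  assumes "finite K" "Poly_Mapping.keys m \<subseteq> K"
  shows "slice_degree k m = (\<Sum>v\<in>K. if snd (snd v) = k then Poly_Mapping.lookup m v else 0)"
proof -
  have "slice_degree k m =
      (\<Sum>v\<in>Poly_Mapping.keys m. if snd (snd v) = k then Poly_Mapping.lookup m v else 0)"
    unfolding slice_degree_def by (rule sum.inter_filter) simp
  also have "\<dots> = (\<Sum>v\<in>K. if snd (snd v) = k then Poly_Mapping.lookup m v else 0)"
    using assms by (intro sum.mono_neutral_left) (auto simp: in_keys_iff)
  finally show ?thesis .
qed

lemma slice_degree_add: "slice_degree k (m + m') = slice_degree k m + slice_degree k m'"
proof -
  let ?K = "Poly_Mapping.keys m \<union> Poly_Mapping.keys m'"
  let ?d = "\<lambda>m. \<Sum>v\<in>?K. if snd (snd v) = k then Poly_Mapping.lookup m v else 0"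
  have "slice_degree k (m + m') = ?d (m + m')"
    by (rule slice_degree_superset) (use keys_add[of m m'] in auto)
  also have "\<dots> = ?d m + ?d m'"
    unfolding sum.distrib[symmetric] by (intro sum.cong refl) (simp add: lookup_add)
  also have "\<dots> = slice_degree k m + slice_degree k m'"
    by (simp add: slice_degree_superset[of ?K])
  finally show ?thesis .
qed

lemma slice_degree_0 [simp]: "slice_degree k 0 = 0"
  by (simp add: slice_degree_def)

lemma slice_degree_single:
  "slice_degree k (Poly_Mapping.single v e) = (if snd (snd v) = k then e else 0)"
  by (subst slice_degree_superset[of "{v}"]) auto

text \<open>The total degree over both slices is used because the entries of \<open>X + Y\<close>
  mix the bidegrees (1, 0) and (0, 1).\<close>

definition slice_homogeneous :: "nat \<Rightarrow> tvar cpoly set" where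
  "slice_homogeneous d =
     {p. \<forall>m \<in> Poly_Mapping.keys p. slice_degree 1 m + slice_degree 2 m = d}"

lemma slice_homogeneous_0 [simp]: "0 \<in> slice_homogeneous d"
  and slice_homogeneous_1 [simp]: "1 \<in> slice_homogeneous 0"
  by (auto simp: slice_homogeneous_def)

lemma slice_homogeneous_Var:
  "k = 1 \<or> k = 2 \<Longrightarrow> Var (i, j, k) \<in> slice_homogeneous 1"
  by (auto simp: slice_homogeneous_def Var_def slice_degree_single)

lemma slice_homogeneous_add:
  "p \<in> slice_homogeneous d \<Longrightarrow> q \<in> slice_homogeneous d \<Longrightarrow> p + q \<in> slice_homogeneous d"
  using keys_add[of p q] by (auto simp: slice_homogeneous_def)

lemma slice_homogeneous_uminus: "p \<in> slice_homogeneous d \<Longrightarrow> - p \<in> slice_homogeneous d"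
  by (simp add: slice_homogeneous_def)

lemma slice_homogeneous_mult:
  assumes "p \<in> slice_homogeneous d" "q \<in> slice_homogeneous e"
  shows "p * q \<in> slice_homogeneous (d + e)"
  unfolding slice_homogeneous_def
proof (intro CollectI ballI)
  fix m assume "m \<in> Poly_Mapping.keys (p * q)"
  then obtain a b where "m = a + b" "a \<in> Poly_Mapping.keys p" "b \<in> Poly_Mapping.keys q"
    using keys_mult[of p q] by blast
  then show "slice_degree 1 m + slice_degree 2 m = d + e"
    using assms by (auto simp: slice_homogeneous_def slice_degree_add)
qed

lemma slice_homogeneous_sum:
  "(\<And>x. x \<in> K \<Longrightarrow> f x \<in> slice_homogeneous d) \<Longrightarrow> sum f K \<in> slice_homogeneous d"
  by (induction K rule: infinite_finite_induct) (simp_all add: slice_homogeneous_add)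

lemma slice_homogeneous_prod:
  "finite K \<Longrightarrow> (\<And>x. x \<in> K \<Longrightarrow> f x \<in> slice_homogeneous 1) \<Longrightarrow>
    prod f K \<in> slice_homogeneous (card K)"
proof (induction K rule: finite_induct)
  case (insert x K)
  then show ?case using slice_homogeneous_mult[of "f x" 1 "prod f K" "card K"] by simp
qed simp

text \<open>Each Leibniz term is, up to sign, a product of \<open>n\<close> entries of total degree
  1.\<close>

lemma slice_homogeneous_det:
  assumes "M \<in> carrier_mat n n"
    and "\<And>i j. i < n \<Longrightarrow> j < n \<Longrightarrow> M $$ (i, j) \<in> slice_homogeneous 1"
  shows "det M \<in> slice_homogeneous n"
  unfolding det_def'[OF assms(1)]
proof (rule slice_homogeneous_sum)
  fix p assume "p \<in> {p. p permutes {0..<n}}"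
  then have "(\<Prod>i=0..<n. M $$ (i, p i)) \<in> slice_homogeneous (card {0..<n})"
    by (intro slice_homogeneous_prod assms(2)) (auto dest: permutes_in_image)
  then show "signof p * (\<Prod>i=0..<n. M $$ (i, p i)) \<in> slice_homogeneous n"
    by (auto simp: sign_def slice_homogeneous_uminus)
qed

lemma poly_ring_det:
  assumes "M \<in> carrier_mat n n"
    and "\<And>i j. i < n \<Longrightarrow> j < n \<Longrightarrow> M $$ (i, j) \<in> poly_ring V"
  shows "det M \<in> poly_ring V"
  unfolding det_def'[OF assms(1)]
proof (rule poly_ring_sum)
  fix p assume "p \<in> {p. p permutes {0..<n}}"
  then have "(\<Prod>i=0..<n. M $$ (i, p i)) \<in> poly_ring V"
    by (intro poly_ring_prod assms(2)) (auto dest: permutes_in_image)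
  then show "signof p * (\<Prod>i=0..<n. M $$ (i, p i)) \<in> poly_ring V"
    by (auto simp: sign_def poly_ring_uminus)
qed

lemma lookup_bidegree_part:
  "Poly_Mapping.lookup (bidegree_part a b p) m =
     (if slice_degree 1 m = a \<and> slice_degree 2 m = b then Poly_Mapping.lookup p m else 0)"
  by (auto simp: bidegree_part_def lookup_sum lookup_single when_def sum.delta in_keys_iff)

text \<open>A monomial of total degree \<open>n\<close> lies in exactly one of these parts:
  \<open>k\<close> must be its degree in the first slice, and its degree in the second is then
  \<open>n - k\<close>.\<close>

lemma sum_bidegree_part:
  assumes "p \<in> slice_homogeneous n"
  shows "(\<Sum>k=0..n. bidegree_part k (n - k) p) = p"
proof (rule poly_mapping_eqI)
  fix m
  have "(\<Sum>k=0..n. Poly_Mapping.lookup (bidegree_part k (n - k) p) m) =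
      (\<Sum>k=0..n. if k = slice_degree 1 m then Poly_Mapping.lookup p m else 0)"
    using assms by (intro sum.cong refl)
      (force simp: lookup_bidegree_part slice_homogeneous_def in_keys_iff)
  also have "\<dots> = Poly_Mapping.lookup p m"
    using assms by (force simp: slice_homogeneous_def in_keys_iff)
  finally show "Poly_Mapping.lookup (\<Sum>k=0..n. bidegree_part k (n - k) p) m = Poly_Mapping.lookup p m"
    by (simp add: lookup_sum)
qed

text \<open>The specialisation \<open>X \<mapsto> P\<close>, \<open>Y \<mapsto> Q\<close>. Other
  third indices get 0, a value unaffected by rescaling \<open>P\<close> and \<open>Q\<close>, so the
  scaling law below holds for every monomial.\<close>

definition slice_subst :: "(nat \<Rightarrow> nat \<Rightarrow> 'w cpoly) \<Rightarrow> (nat \<Rightarrow> nat \<Rightarrow> 'w cpoly) \<Rightarrow> tvar \<Rightarrow> 'w cpoly"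
  where "slice_subst P Q = (\<lambda>(i, j, k). if k = 1 then P i j else if k = 2 then Q i j else 0)"

lemma monom_subst_slice_scale:
  "monom_subst (slice_subst (\<lambda>i j. s * P i j) (\<lambda>i j. t * Q i j)) m =
     s ^ slice_degree 1 m * t ^ slice_degree 2 m * monom_subst (slice_subst P Q) m"
proof -
  let ?K = "Poly_Mapping.keys m"
  let ?e = "\<lambda>k v. if snd (snd v) = k then Poly_Mapping.lookup m v else 0"
  have "monom_subst (slice_subst (\<lambda>i j. s * P i j) (\<lambda>i j. t * Q i j)) m =
    (\<Prod>v\<in>?K. s ^ ?e 1 v * t ^ ?e 2 v * slice_subst P Q v ^ Poly_Mapping.lookup m v)"
    unfolding monom_subst_def
    by (intro prod.cong refl) (auto simp: slice_subst_def power_mult_distrib in_keys_iff)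
  also have "\<dots> = s ^ slice_degree 1 m * t ^ slice_degree 2 m * monom_subst (slice_subst P Q) m"
    unfolding prod.distrib power_sum[symmetric] monom_subst_def
    by (simp add: slice_degree_superset[of ?K])
  finally show ?thesis .
qed

text \<open>All monomials of one bidegree part acquire the same factor; this makes the parts of the
  determinant the coefficients of a form in \<open>s\<close> and \<open>t\<close>.\<close>

lemma poly_subst_slice_scale:
  "poly_subst (slice_subst (\<lambda>i j. s * P i j) (\<lambda>i j. t * Q i j)) (bidegree_part a b p) =
     s ^ a * t ^ b * poly_subst (slice_subst P Q) (bidegree_part a b p)"
  unfolding bidegree_part_def poly_subst_sum sum_distrib_left poly_subst_single
  by (intro sum.cong refl) (auto simp: monom_subst_slice_scale mult_ac)

lemma slice_carrier [simp]: "slice n k \<in> carrier_mat n n"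
  by (simp add: slice_def)

text \<open>The left side is the image of \<open>det (X + Y)\<close> under
  \<open>X \<mapsto> s P\<close>, \<open>Y \<mapsto> t Q\<close>. Here \<open>s\<close> and
  \<open>t\<close> are arbitrary elements of the target ring: constants serve for comparing
  coefficients, \<open>xbar\<close> and \<open>ybar\<close> for the equivariance.\<close>

lemma det_pencil:
  "det (mat n n (\<lambda>(i, j). s * P (Suc i) (Suc j) + t * Q (Suc i) (Suc j))) =
     (\<Sum>k=0..n. s ^ k * t ^ (n - k) * poly_subst (slice_subst P Q) (det_part n k))"
proof -
  let ?\<sigma> = "slice_subst (\<lambda>i j. s * P i j) (\<lambda>i j. t * Q i j)"
  have "mat n n (\<lambda>(i, j). s * P (Suc i) (Suc j) + t * Q (Suc i) (Suc j)) =
      map_mat (poly_subst ?\<sigma>) (slice n 1 + slice n 2)"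
    by (rule eq_matI) (auto simp: slice_def poly_subst_hom slice_subst_def)
  then have "det (mat n n (\<lambda>(i, j). s * P (Suc i) (Suc j) + t * Q (Suc i) (Suc j))) =
      poly_subst ?\<sigma> (det (slice n 1 + slice n 2))"
    by (simp add: comm_ring_hom.hom_det[OF comm_ring_hom_poly_subst])
  also have "det (slice n 1 + slice n 2) = (\<Sum>k=0..n. det_part n k)"
    unfolding det_part_def
    by (rule sum_bidegree_part[symmetric], rule slice_homogeneous_det)
       (auto simp: slice_def simp del: One_nat_def
         intro!: slice_homogeneous_add slice_homogeneous_Var)
  finally show ?thesis
    by (simp add: poly_subst_sum det_part_def poly_subst_slice_scale)
qed

lemma det_part_in_poly_ring: "det_part n k \<in> poly_ring (tensor_vars n)"
proof -
  have "det (slice n 1 + slice n 2) \<in> poly_ring (tensor_vars n)"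
    by (rule poly_ring_det)
       (auto simp: slice_def tensor_vars_def intro!: poly_ring_add)
  then show ?thesis
    by (auto simp: det_part_def poly_ring_def in_keys_iff lookup_bidegree_part split: if_splits)
qed

lemma det_part_subalgebra_subset:
  "subalgebra_gen (det_part n ` {0..n}) \<subseteq> poly_ring (tensor_vars n)"
proof
  fix p assume "p \<in> subalgebra_gen (det_part n ` {0..n})"
  then show "p \<in> poly_ring (tensor_vars n)"
    by induction (auto intro: poly_ring_add poly_ring_mult det_part_in_poly_ring)
qed


section \<open>The action on the coefficients \<open>f\<^bsub>k,n-k\<^esub>\<close>\<close>

lemma poly_subst_tensor_act:
  assumes "p \<in> poly_ring (tensor_vars n)"
  shows "poly_subst (slice_subst P Q) (tensor_act A p) =
    poly_subst (slice_subst
      (\<lambda>i j. Const (A $$ (0,0)) * P i j + Const (A $$ (1,0)) * Q i j)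
      (\<lambda>i j. Const (A $$ (0,1)) * P i j + Const (A $$ (1,1)) * Q i j)) p"
  unfolding tensor_act_def poly_subst_poly_subst
  by (rule poly_subst_cong[OF assms])
     (auto simp: tensor_vars_def slice_subst_def poly_subst_hom)

text \<open>With \<alpha>, \<beta>, \<gamma>, \<delta> the entries of \<open>A\<close>, the pencil
  s(\<alpha>P + \<gamma>Q) + t(\<beta>P + \<delta>Q) regroups as (\<alpha>s + \<beta>t)P +
  (\<gamma>s + \<delta>t)Q, and \<open>det_pencil\<close> applies to both forms.\<close>

lemma det_pencil_act:
  "(\<Sum>k=0..n. s ^ k * t ^ (n - k) * poly_subst (slice_subst P Q) (tensor_act A (det_part n k))) =
   (\<Sum>k=0..n. (Const (A $$ (0,0)) * s + Const (A $$ (0,1)) * t) ^ k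
      * (Const (A $$ (1,0)) * s + Const (A $$ (1,1)) * t) ^ (n - k)
      * poly_subst (slice_subst P Q) (det_part n k))"
proof -
  let ?P' = "\<lambda>i j. Const (A $$ (0,0)) * P i j + Const (A $$ (1,0)) * Q i j"
    and ?Q' = "\<lambda>i j. Const (A $$ (0,1)) * P i j + Const (A $$ (1,1)) * Q i j"
  let ?s = "Const (A $$ (0,0)) * s + Const (A $$ (0,1)) * t"
    and ?t = "Const (A $$ (1,0)) * s + Const (A $$ (1,1)) * t"
  have "(\<Sum>k=0..n. s ^ k * t ^ (n - k) * poly_subst (slice_subst P Q) (tensor_act A (det_part n k))) =
      det (mat n n (\<lambda>(i, j). s * ?P' (Suc i) (Suc j) + t * ?Q' (Suc i) (Suc j)))"
    unfolding poly_subst_tensor_act[OF det_part_in_poly_ring] by (rule det_pencil[symmetric])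
  also have "\<dots> = det (mat n n (\<lambda>(i, j). ?s * P (Suc i) (Suc j) + ?t * Q (Suc i) (Suc j)))"
    by (intro arg_cong[of _ _ det] cong_mat refl) (simp add: algebra_simps)
  also have "\<dots> = (\<Sum>k=0..n. ?s ^ k * ?t ^ (n - k) * poly_subst (slice_subst P Q) (det_part n k))"
    by (rule det_pencil)
  finally show ?thesis .
qed

text \<open>The choice \<open>P = X\<close>, \<open>Q = Y\<close> of the generic slices lets
  \<open>det_pencil_act\<close> be read inside the tensor ring itself.\<close>

lemma poly_subst_slice_Var:
  assumes "p \<in> poly_ring (tensor_vars n)"
  shows "poly_subst (slice_subst (\<lambda>i j. Var (i, j, 1)) (\<lambda>i j. Var (i, j, 2))) p = p"
proof -
  have "poly_subst (slice_subst (\<lambda>i j. Var (i, j, 1)) (\<lambda>i j. Var (i, j, 2))) p = poly_subst Var p"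
  proof (rule poly_subst_cong[OF assms])
    fix v assume "v \<in> tensor_vars n"
    then obtain i j k where "v = (i, j, k)" "k = 1 \<or> k = 2" by (force simp: tensor_vars_def)
    then show "slice_subst (\<lambda>i j. Var (i, j, 1)) (\<lambda>i j. Var (i, j, 2)) v = Var v"
      by (auto simp: slice_subst_def)
  qed
  then show ?thesis by simp
qed

lemma Const_eq_iff: "Const a = Const b \<longleftrightarrow> a = b"
  by (metis Const_def lookup_single_eq)

lemma Const_sum: "Const (sum f K) = (\<Sum>x\<in>K. Const (f x))"
  by (induction K rule: infinite_finite_induct) (simp_all add: Const_add)

text \<open>The polynomial version is evaluated at constants and pulled back along the injective
  ring homomorphism \<open>Const\<close>.\<close>

lemma linear_forms_product_complex:
  fixes a b a' b' :: complex
  shows "\<exists>c. \<forall>s t. (a * s + b * t) ^ k * (a' * s + b' * t) ^ l =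
    (\<Sum>j=0..k+l. c j * s ^ j * t ^ (k + l - j))"
proof -
  obtain c where c: "\<forall>x y :: fvar cpoly.
    (Const a * x + Const b * y) ^ k * (Const a' * x + Const b' * y) ^ l =
     (\<Sum>j=0..k+l. Const (c j) * x ^ j * y ^ (k + l - j))"
    using linear_forms_product by blast
  have "(a * s + b * t) ^ k * (a' * s + b' * t) ^ l =
    (\<Sum>j=0..k+l. c j * s ^ j * t ^ (k + l - j))" for s t
    using c[rule_format, of "Const s" "Const t"]
    by (simp only: Const_mult[symmetric] Const_add[symmetric] Const_power Const_sum[symmetric] Const_eq_iff)
  then show ?thesis by blast
qed

text \<open>Comparing coefficients in \<open>det_pencil_act\<close> shows that the action mixes the
  \<open>det_part n k\<close> linearly, so the subalgebra they generate is stable.\<close>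

lemma tensor_act_det_part:
  assumes "j \<le> n"
  shows "tensor_act A (det_part n j) \<in> subalgebra_gen (det_part n ` {0..n})"
proof -
  let ?a = "A $$ (0,0)" and ?b = "A $$ (0,1)" and ?c = "A $$ (1,0)" and ?d = "A $$ (1,1)"
  have "\<forall>k. \<exists>e. \<forall>s t. (?a * s + ?b * t) ^ k * (?c * s + ?d * t) ^ (n - k) =
    (\<Sum>j=0..k+(n-k). e j * s ^ j * t ^ (k + (n - k) - j))"
    by (intro allI linear_forms_product_complex)
  \<comment> \<open>For \<open>k \<le> n\<close>, \<open>e k j\<close> is the coefficient of s^j
    t^(n-j) in (\<alpha>s + \<beta>t)^k (\<gamma>s + \<delta>t)^(n-k).\<close>
  from choice[OF this] obtain e where e: "\<And>k s t. (?a * s + ?b * t) ^ k * (?c * s + ?d * t) ^ (n - k) =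
    (\<Sum>j=0..k+(n-k). e k j * s ^ j * t ^ (k + (n - k) - j))" by blast
  have act_in: "tensor_act A (det_part n k) \<in> poly_ring (tensor_vars n)" for k
    unfolding tensor_act_def using det_part_in_poly_ring
    by (rule poly_subst_in_poly_ring)
       (auto intro!: poly_ring_add poly_ring_mult simp: tensor_vars_def)
  have "tensor_act A (det_part n j) = (\<Sum>k=0..n. Const (e k j) * det_part n k)"
  proof (rule poly_coeffs_eqI[OF _ assms])
    fix s
    have "(\<Sum>k=0..n. Const (s ^ k) * tensor_act A (det_part n k)) =
      (\<Sum>k=0..n. (Const ?a * Const s + Const ?b) ^ k * (Const ?c * Const s + Const ?d) ^ (n - k)
        * det_part n k)"
      \<comment> \<open>Setting \<open>t = 1\<close> loses nothing, since the exponent of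
        \<open>s\<close> alone identifies each term.\<close>
      using det_pencil_act[of "Const s" 1 n "\<lambda>i j. Var (i, j, 1 :: nat)" "\<lambda>i j. Var (i, j, 2)" A]
      by (simp add: poly_subst_slice_Var[OF act_in] poly_subst_slice_Var[OF det_part_in_poly_ring]
          Const_power del: One_nat_def)
    also have "\<dots> = (\<Sum>k=0..n. (\<Sum>j=0..n. Const (e k j) * Const (s ^ j)) * det_part n k)"
    proof (intro sum.cong refl arg_cong2[of _ _ _ _ "(*)"])
      fix k assume "k \<in> {0..n}"
      then show "(Const ?a * Const s + Const ?b) ^ k * (Const ?c * Const s + Const ?d) ^ (n - k) =
          (\<Sum>j=0..n. Const (e k j) * Const (s ^ j))"
        using e[of s 1 k]
        by (simp add: Const_mult[symmetric] Const_add[symmetric] Const_power Const_sum[symmetric])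
    qed
    also have "\<dots> = (\<Sum>k=0..n. \<Sum>j=0..n. Const (s ^ j) * (Const (e k j) * det_part n k))"
      unfolding sum_distrib_right by (intro sum.cong refl) (simp only: mult_ac)
    also have "\<dots> = (\<Sum>j=0..n. Const (s ^ j) * (\<Sum>k=0..n. Const (e k j) * det_part n k))"
      by (subst sum.swap) (simp add: sum_distrib_left)
    finally show "(\<Sum>k=0..n. Const (s ^ k) * tensor_act A (det_part n k)) =
      (\<Sum>j=0..n. Const (s ^ j) * (\<Sum>k=0..n. Const (e k j) * det_part n k))" .
  qed
  also have "\<dots> \<in> subalgebra_gen (det_part n ` {0..n})"
    by (intro subalgebra_gen_sum subalgebra_gen.mult subalgebra_gen.Const subalgebra_gen.gen) auto
  finally show ?thesis .
qed


section \<open>The companion pencil\<close>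

text \<open>Laplace expansion along the last row, which is zero outside its first and last entries.
  Removing the last column leaves the same matrix one size smaller; removing the first leaves a
  lower triangular matrix with \<open>- s\<close> on the diagonal, whose sign cancels that of the
  cofactor.\<close>

lemma det_companion:
  fixes a :: "nat \<Rightarrow> 'a :: comm_ring_1"
  shows "det (mat (Suc n) (Suc n) (\<lambda>(i, j).
      if j = 0 then a i else if j = Suc i then - s else if j = i then t else 0)) =
    (\<Sum>i=0..n. a i * s ^ i * t ^ (n - i))"
proof (induction n)
  case 0
  show ?case by (subst det_single) auto
next
  case (Suc n)
  let ?e = "\<lambda>(i, j). if j = 0 then a i else if j = Suc i then - s else if j = i then t else 0"
  let ?M = "mat (Suc (Suc n)) (Suc (Suc n)) ?e"
  let ?L = "mat_delete ?M (Suc n) 0"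
  have L: "?L \<in> carrier_mat (Suc n) (Suc n)" by (simp add: mat_delete_def)
  have Lii: "?L $$ (i, j) = (if j = i then - s else if Suc j = i then t else 0)"
    if "i < Suc n" "j < Suc n" for i j
    using that by (auto simp: mat_delete_def)
  have "det ?L = prod_list (diag_mat ?L)"
    by (rule det_lower_triangular[OF _ L]) (subst Lii, auto)
  also have "diag_mat ?L = replicate (Suc n) (- s)"
    using L by (intro nth_equalityI) (auto simp: diag_mat_def Lii simp del: upt_Suc replicate_Suc)
  finally have det_L: "det ?L = (- s) ^ Suc n" by simp
  have "mat_delete ?M (Suc n) (Suc n) = mat (Suc n) (Suc n) ?e"
    by (rule eq_matI) (auto simp: mat_delete_def)
  with Suc.IH have det_R: "det (mat_delete ?M (Suc n) (Suc n)) = (\<Sum>i=0..n. a i * s ^ i * t ^ (n - i))"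
    by simp
  have "det ?M = (\<Sum>j<Suc (Suc n). ?M $$ (Suc n, j) * cofactor ?M (Suc n) j)"
    by (rule laplace_expansion_row) auto
  also have "\<dots> = (\<Sum>j\<in>{0, Suc n}. ?M $$ (Suc n, j) * cofactor ?M (Suc n) j)"
    by (intro sum.mono_neutral_right) auto
  also have "\<dots> = a (Suc n) * ((-1) ^ Suc n * (- s) ^ Suc n) + t * (\<Sum>i=0..n. a i * s ^ i * t ^ (n - i))"
    by (simp add: cofactor_def det_L det_R del: power_Suc)
  also have "(-1) ^ Suc n * (- s) ^ Suc n = s ^ Suc n"
    by (simp only: power_mult_distrib[symmetric]) simp
  also have "t * (\<Sum>i=0..n. a i * s ^ i * t ^ (n - i)) = (\<Sum>i=0..n. a i * s ^ i * t ^ (Suc n - i))"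
    unfolding sum_distrib_left by (intro sum.cong) (auto simp: Suc_diff_le mult_ac)
  finally show ?case by (simp add: add.commute del: power_Suc)
qed

text \<open>Indices start at 1, as for the tensor. The pencil has \<open>t\<close> on the diagonal
  and \<open>- s\<close> above it from column 2 on. The first column must hold \<open>n + 1\<close>
  coefficients in \<open>n\<close> entries linear in \<open>s\<close> and \<open>t\<close>: row
  \<open>i\<close> carries \<open>t * c (i - 1)\<close>, and the last row carries
  \<open>s * c n\<close> as well.\<close>

definition companion_X :: "nat \<Rightarrow> (nat \<Rightarrow> 'w cpoly) \<Rightarrow> nat \<Rightarrow> nat \<Rightarrow> 'w cpoly" where
  "companion_X n c i j =
     (if j = 1 then (if i = n then c n else 0) else if j = Suc i then - 1 else 0)"

definition companion_Y :: "(nat \<Rightarrow> 'w cpoly) \<Rightarrow> nat \<Rightarrow> nat \<Rightarrow> 'w cpoly" where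
  "companion_Y c i j = (if j = 1 then c (i - 1) else if j = i then 1 else 0)"

lemma det_companion_pencil:
  assumes "n \<ge> 1"
  shows "det (mat n n (\<lambda>(i, j).
      s * companion_X n c (Suc i) (Suc j) + t * companion_Y c (Suc i) (Suc j))) =
    (\<Sum>k=0..n. s ^ k * t ^ (n - k) * c k)"
proof -
  obtain m where m: "n = Suc m" using assms by (cases n) auto
  \<comment> \<open>The last entry accounts for two terms of the sum, \<open>s ^ m * t * c m\<close>
    and \<open>s ^ n * c n\<close>.\<close>
  let ?a = "\<lambda>i. t * c i + (if i = m then s * c (Suc m) else 0)"
  have "mat n n (\<lambda>(i, j). s * companion_X n c (Suc i) (Suc j) + t * companion_Y c (Suc i) (Suc j)) =
    mat (Suc m) (Suc m) (\<lambda>(i, j).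
      if j = 0 then ?a i else if j = Suc i then - s else if j = i then t else 0)"
    by (rule eq_matI) (auto simp: m companion_X_def companion_Y_def)
  then have "det (mat n n (\<lambda>(i, j).
      s * companion_X n c (Suc i) (Suc j) + t * companion_Y c (Suc i) (Suc j))) =
    (\<Sum>i=0..m. ?a i * s ^ i * t ^ (m - i))"
    by (simp only: det_companion)
  also have "\<dots> = (\<Sum>i=0..m. s ^ i * t ^ (n - i) * c i + (if i = m then s ^ n * c n else 0))"
    by (intro sum.cong refl) (auto simp: m Suc_diff_le algebra_simps)
  also have "\<dots> = (\<Sum>k=0..n. s ^ k * t ^ (n - k) * c k)"
    by (simp add: sum.distrib m)
  finally show ?thesis .
qed

text \<open>The companion determinant is expanded by \<open>det_pencil\<close> and by
  \<open>det_companion_pencil\<close>; coefficients are compared at \<open>t = 1\<close> with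
  \<open>s\<close> constant.\<close>

lemma poly_subst_companion:
  assumes "n \<ge> 1" "k \<le> n"
  shows "poly_subst (slice_subst (companion_X n c) (companion_Y c)) (det_part n k) = c k"
proof -
  let ?f = "\<lambda>k. poly_subst (slice_subst (companion_X n c) (companion_Y c)) (det_part n k)"
  have "(\<Sum>k=0..n. Const (s ^ k) * ?f k) = (\<Sum>k=0..n. Const (s ^ k) * c k)" for s
  proof -
    have "(\<Sum>k=0..n. Const s ^ k * 1 ^ (n - k) * ?f k) = (\<Sum>k=0..n. Const s ^ k * 1 ^ (n - k) * c k)"
      by (rule trans[OF det_pencil[symmetric] det_companion_pencil[OF assms(1)]])
    then show ?thesis by (simp only: Const_power power_one mult_1_right)
  qed
  then show ?thesis using assms(2) by (rule poly_coeffs_eqI[where g = ?f and h = c])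
qed

lemma slice_subst_in_poly_ring:
  assumes "\<And>i j. i \<in> {1..n} \<Longrightarrow> j \<in> {1..n} \<Longrightarrow> P i j \<in> poly_ring W"
    and "\<And>i j. i \<in> {1..n} \<Longrightarrow> j \<in> {1..n} \<Longrightarrow> Q i j \<in> poly_ring W"
    and "p \<in> poly_ring (tensor_vars n)"
  shows "poly_subst (slice_subst P Q) p \<in> poly_ring W"
  using assms(3)
  by (rule poly_subst_in_poly_ring) (auto simp: slice_subst_def tensor_vars_def assms(1,2))


section \<open>The isomorphism\<close>

lemma is_xibar_xibar: "A \<in> SL2 \<Longrightarrow> is_xibar n A (xibar n A)"
  unfolding xibar_def by (rule theI'[OF xibar_unique])

text \<open>This is the uniqueness of the transformed coefficients. As \<open>is_xibar\<close> asks
  for extensional functions, \<open>g\<close> is first restricted to \<open>{0..n}\<close>.\<close>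

lemma xibar_eqI:
  assumes "A \<in> SL2" "\<And>k. k \<le> n \<Longrightarrow> g k \<in> poly_ring (Xi ` {0..n})"
    and "binary_form n (\<lambda>k. Var (Xi k)) (Var Xvar) (Var Yvar) = binary_form n g (xbar A) (ybar A)"
    and "k \<le> n"
  shows "xibar n A k = g k"
proof -
  have "is_xibar n A (restrict g {0..n})"
    using assms(2,3) by (auto simp: is_xibar_def binary_form_def)
  then have "xibar n A = restrict g {0..n}"
    using xibar_unique[OF assms(1)] is_xibar_xibar[OF assms(1)] by blast
  then show ?thesis using \<open>k \<le> n\<close> by simp
qed

lemma SL2_mult_closed: "A \<in> SL2 \<Longrightarrow> B \<in> SL2 \<Longrightarrow> A * B \<in> SL2"
  by (auto simp: SL2_def det_mult)

lemma one_in_SL2: "1\<^sub>m 2 \<in> SL2"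
  by (simp add: SL2_def)

text \<open>Every element of \<open>W\<close> is an image under \<open>\<phi>\<close>, so closure,
  unit law and composition law carry over from \<open>V\<close>. This avoids proving the group law
  for \<open>form_act\<close> from the definite description of \<open>xibar\<close>.\<close>

lemma SL2_module_iso_transport:
  assumes V: "SL2_module V act" and W: "linear_subspace W"
    and act': "\<And>A. A \<in> SL2 \<Longrightarrow> linear_map_on W (act' A)"
    and bij: "bij_betw \<phi> V W" and lin: "linear_map_on V \<phi>"
    and equiv: "\<And>A p. A \<in> SL2 \<Longrightarrow> p \<in> V \<Longrightarrow> \<phi> (act A p) = act' A (\<phi> p)"
  shows "SL2_module_iso V act W act' \<phi>"
proof -
  have img: "W = \<phi> ` V" using bij by (simp add: bij_betw_def)
  have closed: "act A p \<in> V" if "A \<in> SL2" "p \<in> V" for A p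
    using V that by (auto simp: SL2_module_def)
  have "act' A ` W \<subseteq> W" if "A \<in> SL2" for A
    using closed that by (auto simp: img equiv[symmetric])
  moreover have "act' (1\<^sub>m 2) q = q" if "q \<in> W" for q
    using that V by (auto simp: img equiv[symmetric] one_in_SL2 SL2_module_def)
  moreover have "act' (A * B) q = act' A (act' B q)" if "A \<in> SL2" "B \<in> SL2" "q \<in> W" for A B q
    using that V by (auto simp: img equiv[symmetric] SL2_mult_closed closed SL2_module_def)
  ultimately have "SL2_module W act'"
    using W act' by (simp add: SL2_module_def)
  then show ?thesis using V bij lin equiv by (simp add: SL2_module_iso_def)
qed

theorem theorem4p8:
  fixes n :: nat
  assumes "n \<ge> 1"
  shows "\<exists>\<phi> :: tvar cpoly \<Rightarrow> fvar cpoly.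
    alg_hom_on (subalgebra_gen (det_part n ` {0..n})) \<phi> \<and>
    (\<forall>k\<in>{0..n}. \<phi> (det_part n k) = of_nat (n choose k) * Var (Xi k)) \<and>
    SL2_module_iso
      (subalgebra_gen (det_part n ` {0..n})) tensor_act
      (poly_ring (Xi ` {0..n})) (form_act n) \<phi>"
proof -
  let ?V = "subalgebra_gen (det_part n ` {0..n})" and ?W = "poly_ring (Xi ` {0..n})"
  \<comment> \<open>The binomial factors are put into the coefficients of the pencil, so that
    \<open>\<phi>\<close> takes exactly the prescribed values.\<close>
  define c :: "nat \<Rightarrow> fvar cpoly" where "c = (\<lambda>k. of_nat (n choose k) * Var (Xi k))"
  let ?P = "companion_X n c" and ?Q = "companion_Y c"
  define \<phi> where "\<phi> = poly_subst (slice_subst ?P ?Q)"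
  \<comment> \<open>The candidate inverse undoes the binomial factor. Its value 0 at
    \<open>Xvar\<close> and \<open>Yvar\<close> is arbitrary, as \<open>?W\<close> contains
    neither.\<close>
  define \<rho> where "\<rho> = poly_subst (\<lambda>v. case v of
      Xi k \<Rightarrow> Const (1 / of_nat (n choose k)) * det_part n k | _ \<Rightarrow> 0)"
  have \<phi>_part: "\<phi> (det_part n k) = c k" if "k \<le> n" for k
    unfolding \<phi>_def using poly_subst_companion[OF assms that] .
  have c_in: "c k \<in> ?W" if "k \<le> n" for k
    using poly_ring_mult[OF poly_ring_Const[of "of_nat (n choose k)"], of "Var (Xi k)"] that
    by (simp add: c_def)
  have \<phi>_ring: "\<phi> p \<in> ?W" if "p \<in> poly_ring (tensor_vars n)" for p
    unfolding \<phi>_def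
    by (rule slice_subst_in_poly_ring[OF _ _ that])
       (auto simp: companion_X_def companion_Y_def intro!: c_in poly_ring_uminus)
  have \<phi>_hom: "\<phi> (p + q) = \<phi> p + \<phi> q" "\<phi> (p * q) = \<phi> p * \<phi> q" "\<phi> (Const x) = Const x" for p q x
    by (simp_all add: \<phi>_def poly_subst_hom)
  have V_gen: "det_part n k \<in> ?V" if "k \<le> n" for k
    using that by (intro subalgebra_gen.gen) auto
  have V_ring: "p \<in> poly_ring (tensor_vars n)" if "p \<in> ?V" for p
    using that det_part_subalgebra_subset by blast

  \<comment> \<open>Bijectivity\<close>
  have \<rho>_c: "\<rho> (c k) = det_part n k" if "k \<le> n" for k
    using that by (simp add: \<rho>_def c_def poly_subst_hom of_nat_Const_inverse_mult)
  have gen_W: "?W = subalgebra_gen ((\<lambda>k. Var (Xi k)) ` {0..n})"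
    by (simp add: poly_ring_eq_subalgebra_gen image_image)
  have \<rho>_Var: "\<rho> (Var (Xi k)) = Const (1 / of_nat (n choose k)) * det_part n k" for k
    by (simp add: \<rho>_def)
  have \<rho>_in: "\<rho> q \<in> ?V" if "q \<in> ?W" for q
    unfolding \<rho>_def using that[unfolded gen_W]
    by (rule poly_subst_in_subalgebra_gen)
       (auto simp flip: \<rho>_def simp: \<rho>_Var intro!: subalgebra_gen.mult subalgebra_gen.Const V_gen)
  have \<rho>\<phi>: "\<rho> (\<phi> p) = p" if "p \<in> ?V" for p
    unfolding \<rho>_def \<phi>_def
    by (rule poly_subst_comp_id_on_subalgebra_gen[OF that], fold \<phi>_def \<rho>_def)
       (auto simp: \<phi>_part \<rho>_c)
  have \<phi>\<rho>: "\<phi> (\<rho> q) = q" if "q \<in> ?W" for q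
    unfolding \<rho>_def \<phi>_def
    by (rule poly_subst_comp_id_on_subalgebra_gen[OF that[unfolded gen_W]], fold \<phi>_def \<rho>_def)
       (auto simp: \<rho>_Var \<phi>_part \<phi>_hom c_def of_nat_Const_inverse_mult)
  have bij: "bij_betw \<phi> ?V ?W"
    by (rule bij_betw_byWitness[where f' = \<rho>]) (auto simp: \<rho>\<phi> \<phi>\<rho> \<rho>_in \<phi>_ring V_ring)

  \<comment> \<open>Equivariance\<close>
  have xibar_c: "\<phi> (tensor_act A (det_part n k)) = of_nat (n choose k) * xibar n A k"
    if A: "A \<in> SL2" and k: "k \<le> n" for A k
  proof -
    \<comment> \<open>The claim forces this formula for \<open>xibar n A\<close>; by uniqueness it
      suffices that \<open>?g\<close> rewrites the generic form in \<open>xbar A\<close> and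
      \<open>ybar A\<close>.\<close>
    let ?g = "\<lambda>k. Const (1 / of_nat (n choose k)) * \<phi> (tensor_act A (det_part n k))"
    have "binary_form n ?g (xbar A) (ybar A) =
        (\<Sum>k=0..n. xbar A ^ k * ybar A ^ (n - k) * \<phi> (tensor_act A (det_part n k)))"
      unfolding binary_form_def
    proof (intro sum.cong refl)
      fix k assume "k \<in> {0..n}"
      then have "of_nat (n choose k) * ?g k = \<phi> (tensor_act A (det_part n k))"
        by (intro of_nat_Const_inverse_mult(1)) simp
      then show "of_nat (n choose k) * ?g k * xbar A ^ k * ybar A ^ (n - k) =
          xbar A ^ k * ybar A ^ (n - k) * \<phi> (tensor_act A (det_part n k))"
        by (simp only: mult_ac)
    qed
    \<comment> \<open>In \<open>det_pencil_act\<close> take \<open>s = xbar A\<close> and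
      \<open>t = ybar A\<close>: the matrix \<open>A\<close> sends this pair back to the variables x
      and y.\<close>
    also have "\<dots> = (\<Sum>k=0..n. Var Xvar ^ k * Var Yvar ^ (n - k) * \<phi> (det_part n k))"
      unfolding \<phi>_def det_pencil_act xbar_ybar[OF A, symmetric] ..
    also have "\<dots> = binary_form n (\<lambda>k. Var (Xi k)) (Var Xvar) (Var Yvar)"
      unfolding binary_form_def by (intro sum.cong refl) (simp add: \<phi>_part c_def mult_ac)
    finally have "xibar n A k = ?g k"
      using tensor_act_module[of n] A
      by (intro xibar_eqI[OF A _ _ k])
         (auto simp: SL2_module_def intro!: poly_ring_mult \<phi>_ring det_part_in_poly_ring)
    then show ?thesis using k by (simp add: of_nat_Const_inverse_mult)
  qed
  have equiv: "\<phi> (tensor_act A p) = form_act n A (\<phi> p)" if "A \<in> SL2" "p \<in> ?V" for A p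
    unfolding \<phi>_def tensor_act_def form_act_def
  proof (rule poly_subst_comp_eq_on_subalgebra_gen[OF that(2)], fold \<phi>_def tensor_act_def form_act_def)
    fix q assume "q \<in> det_part n ` {0..n}"
    then obtain k where k: "k \<le> n" and q: "q = det_part n k" by auto
    have "form_act n A (c k) = of_nat (n choose k) * xibar n A k"
      by (simp add: form_act_def c_def poly_subst_hom)
    then show "\<phi> (tensor_act A q) = form_act n A (\<phi> q)"
      by (simp add: q \<phi>_part k xibar_c that(1))
  qed

  \<comment> \<open>Module structures on both sides\<close>
  have "tensor_act A p \<in> ?V" if "p \<in> ?V" for A p
    unfolding tensor_act_def
    by (rule poly_subst_in_subalgebra_gen[OF that], fold tensor_act_def)
       (auto intro: tensor_act_det_part)
  moreover have "linear_subspace ?V"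
    using subalgebra_gen.Const[of 0] by (auto simp: linear_subspace_def intro: subalgebra_gen.intros)
  ultimately have V: "SL2_module ?V tensor_act"
    using tensor_act_module[of n] V_ring
    by (auto simp: SL2_module_def linear_map_on_def tensor_act_def poly_subst_hom)
  have "SL2_module_iso ?V tensor_act ?W (form_act n) \<phi>"
    by (rule SL2_module_iso_transport[OF V])
       (auto simp: linear_subspace_def linear_map_on_def form_act_def poly_subst_hom \<phi>_hom
         bij equiv[unfolded form_act_def] intro: poly_ring_add poly_ring_mult)
  moreover have "alg_hom_on ?V \<phi>" by (simp add: alg_hom_on_def \<phi>_hom)
  ultimately show ?thesis using \<phi>_part by (intro exI[of _ \<phi>]) (simp add: c_def)
qed

end
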